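(* Let $\mathcal X_\bullet=\mathcal Y_\bullet=\{x\in\mathbb R^d:\|x\|_2\le 1\}$. For any $0<c<1$ and any $0<S<(c+1)/2$, there are no parameters $0<U<1$, integer $m\ge 1$ and $r>0$ such that L2-ALSH(SL) with parameters $m,U,r$ is an $(S,cS)$-ALSH for the inner product similarity $\mathrm{sim}(x,y)=x^\top y$ over $\mathcal X_\bullet,\mathcal Y_\bullet$.
   Context: Here $d$ is the dimension of the ambient space $\mathbb R^d$. An asymmetric hash for a pair of sets $\mathcal X,\mathcal Y$ is a joint probability distribution over pairs of mappings $(f,g)$ with $f:\mathcal X\to\Gamma$ and $g:\mathcal Y\to\Gamma$, where $\Gamma$ is some set (the alphabet). Given $\mathrm{sim}:\mathcal X\times\mathcal Y\to\mathbb R$, an asymmetric hash is an $(S,cS,p_1,p_2)$-ALSH for $\mathrm{sim}$ over $\mathcal X,\mathcal Y$ if for all $x\in\mathcal X$, $y\in\mathcal Y$: (i) if $\mathrm{sim}(x,y)\ge S$ then $\mathbb P_{(f,g)}[f(x)=g(y)]\ge p_1$; (ii) if $\mathrm{sim}(x,y)\le cS$ then $\mathbb P_{(f,g)}[f(x)=g(y)]\le p_2$. It is an $(S,cS)$-ALSH if there exist $p_1,p_2\in[0,1]$ with $p_1>p_2$ such that it is an $(S,cS,p_1,p_2)$-ALSH. L2-ALSH(SL) with parameters $m$ (a positive integer), $0<U<1$ and $r>0$ is the following asymmetric hash. Define maps into $\mathbb R^{d+m}$ by $$P(x)=[Ux;\|Ux\|_2^2;\|Ux\|_2^4;\dots;\|Ux\|_2^{2^m}],\qquad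 Q(y)=[y;1/2;1/2;\dots;1/2]$$ ($m$ appended coordinates each). Let $h_{a,b}(z)=\left\lfloor\frac{a^\top z+b}{r}\right\rfloor$ for $z\in\mathbb R^{d+m}$, where $a\sim\mathcal N(0,I_{d+m})$ and $b$ is uniform on $[0,r]$, independent of $a$. Then $f(x)=h_{a,b}(P(x))$ and $g(y)=h_{a,b}(Q(y))$ (same $a,b$), with alphabet $\mathbb Z$. *)

theory Defs
  imports "HOL-Probability.Probability"
begin

text \<open>
  The alphabet is the type \<open>'k\<close>.  A distribution over pairs of mappings
  \<open>f : X \<rightarrow> 'k\<close>, \<open>g : Y \<rightarrow> 'k\<close> is a probability measure whose sample points are such pairs,
  mappings with a restricted domain being extensional functions.  The collision events must be
  measurable, since otherwise their probabilities would be meaningless.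
\<close>

definition collision ::
    "(('x \<Rightarrow> 'k) \<times> ('y \<Rightarrow> 'k)) measure \<Rightarrow> 'x \<Rightarrow> 'y \<Rightarrow> (('x \<Rightarrow> 'k) \<times> ('y \<Rightarrow> 'k)) set" where
  "collision H x y = {(f, g) \<in> space H. f x = g y}"

definition asymmetric_hash ::
    "'x set \<Rightarrow> 'y set \<Rightarrow> (('x \<Rightarrow> 'k) \<times> ('y \<Rightarrow> 'k)) measure \<Rightarrow> bool" where
  "asymmetric_hash X Y H \<longleftrightarrow>
     prob_space H \<and>
     space H \<subseteq> (X \<rightarrow>\<^sub>E UNIV) \<times> (Y \<rightarrow>\<^sub>E UNIV) \<and>
     (\<forall>x\<in>X. \<forall>y\<in>Y. collision H x y \<in> sets H)"

text \<open>The predicates below are \<open>(S, cS, p1, p2)\<close>-ALSH and \<open>(S, cS)\<close>-ALSH; the argument is \<open>c\<close>,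
  not \<open>cS\<close>.\<close>

definition ALSH_with ::
    "('x \<Rightarrow> 'y \<Rightarrow> real) \<Rightarrow> 'x set \<Rightarrow> 'y set \<Rightarrow> real \<Rightarrow> real \<Rightarrow> real \<Rightarrow> real \<Rightarrow>
     (('x \<Rightarrow> 'k) \<times> ('y \<Rightarrow> 'k)) measure \<Rightarrow> bool" where
  "ALSH_with sim X Y S c p1 p2 H \<longleftrightarrow>
     asymmetric_hash X Y H \<and>
     (\<forall>x\<in>X. \<forall>y\<in>Y.
        (sim x y \<ge> S \<longrightarrow> measure H (collision H x y) \<ge> p1) \<and>
        (sim x y \<le> c * S \<longrightarrow> measure H (collision H x y) \<le> p2))"

definition ALSH ::
    "('x \<Rightarrow> 'y \<Rightarrow> real) \<Rightarrow> 'x set \<Rightarrow> 'y set \<Rightarrow> real \<Rightarrow> real \<Rightarrow>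
     (('x \<Rightarrow> 'k) \<times> ('y \<Rightarrow> 'k)) measure \<Rightarrow> bool" where
  "ALSH sim X Y S c H \<longleftrightarrow>
     (\<exists>p1\<in>{0..1}. \<exists>p2\<in>{0..1}. p1 > p2 \<and> ALSH_with sim X Y S c p1 p2 H)"

text \<open>
  With \<open>d = CARD('n)\<close>, a vector of \<open>\<real>\<^sup>d\<close> is an element of \<open>real ^ 'n\<close>.  As \<open>m\<close> varies, a vector of
  dimension \<open>d + m\<close> is a real-valued extensional function on the index set \<open>ext_index m\<close>:
  \<open>Inl i\<close> are the \<open>d\<close> original coordinates and \<open>Inr j\<close> (\<open>1 \<le> j \<le> m\<close>) the \<open>m\<close> appended ones.
\<close>

definition ext_index :: "nat \<Rightarrow> ('n::finite + nat) set" where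
  "ext_index m = UNIV <+> {1..m}"

definition SL_P :: "nat \<Rightarrow> real \<Rightarrow> real ^ 'n \<Rightarrow> 'n::finite + nat \<Rightarrow> real" where
  "SL_P m U x = (\<lambda>i\<in>ext_index m. case i of Inl i \<Rightarrow> (U *\<^sub>R x) $ i | Inr j \<Rightarrow> norm (U *\<^sub>R x) ^ (2 ^ j))"

definition SL_Q :: "nat \<Rightarrow> real ^ 'n \<Rightarrow> 'n::finite + nat \<Rightarrow> real" where
  "SL_Q m y = (\<lambda>i\<in>ext_index m. case i of Inl i \<Rightarrow> y $ i | Inr j \<Rightarrow> 1 / 2)"

definition std_gaussian :: "nat \<Rightarrow> ('n::finite + nat \<Rightarrow> real) measure" where
  "std_gaussian m = PiM (ext_index m) (\<lambda>_. density lborel std_normal_density)"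

definition L2_hash ::
    "nat \<Rightarrow> real \<Rightarrow> ('n::finite + nat \<Rightarrow> real) \<Rightarrow> real \<Rightarrow> ('n + nat \<Rightarrow> real) \<Rightarrow> int" where
  "L2_hash m r a b z = \<lfloor>((\<Sum>i\<in>ext_index m. a i * z i) + b) / r\<rfloor>"

definition L2_ALSH_SL ::
    "nat \<Rightarrow> real \<Rightarrow> real \<Rightarrow> (real ^ 'n) set \<Rightarrow> (real ^ 'n) set \<Rightarrow>
     ((real ^ 'n \<Rightarrow> int) \<times> (real ^ 'n::finite \<Rightarrow> int)) measure" where
  "L2_ALSH_SL m U r X Y =
     distr (std_gaussian m \<Otimes>\<^sub>M uniform_measure lborel {0..r})
       (PiM X (\<lambda>_. count_space UNIV) \<Otimes>\<^sub>M PiM Y (\<lambda>_. count_space UNIV))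
       (\<lambda>(a, b). (\<lambda>x\<in>X. L2_hash m r a b (SL_P m U x), \<lambda>y\<in>Y. L2_hash m r a b (SL_Q m y)))"

text \<open>L2-ALSH(SL) really is an asymmetric hash, so refuting \<^const>\<open>ALSH\<close> for it refutes the
  collision bounds.\<close>

lemma finite_ext_index: "finite (ext_index m)"
  by (auto simp: ext_index_def)

lemma prob_space_std_gaussian: "prob_space (std_gaussian m)"
  unfolding std_gaussian_def
  by (intro prob_space_PiM prob_space_normal_density) simp

lemma prob_space_uniform:
  fixes r :: real
  assumes "r > 0" shows "prob_space (uniform_measure lborel {0..r})"
  using assms by (intro prob_space_uniform_measure) auto

lemma L2_hash_measurable:
  "(\<lambda>w. L2_hash m r (fst w) (snd w) z)
     \<in> std_gaussian m \<Otimes>\<^sub>M uniform_measure lborel {0..r} \<rightarrow>\<^sub>M count_space UNIV"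
proof -
  have [measurable]: "(\<lambda>w. fst w i) \<in> borel_measurable (std_gaussian m \<Otimes>\<^sub>M uniform_measure lborel {0..r})"
    if "i \<in> ext_index m" for i
  proof -
    have "(\<lambda>a. a i) \<in> std_gaussian m \<rightarrow>\<^sub>M density lborel std_normal_density"
      unfolding std_gaussian_def using that by (rule measurable_component_singleton)
    then have "(\<lambda>a. a i) \<in> borel_measurable (std_gaussian m)"
      by simp
    then show ?thesis
      by (rule measurable_compose[OF measurable_fst])
  qed
  have [measurable]: "snd \<in> borel_measurable (std_gaussian m \<Otimes>\<^sub>M uniform_measure lborel {0..r})"
    using measurable_snd[of "std_gaussian m" "uniform_measure lborel {0..r}"]
    by (simp cong: measurable_cong_sets)
  show ?thesis
    unfolding L2_hash_def by measurable
qed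

lemma L2_ALSH_SL_measurable:
  "(\<lambda>(a, b). (\<lambda>x\<in>X. L2_hash m r a b (SL_P m U x), \<lambda>y\<in>Y. L2_hash m r a b (SL_Q m y)))
     \<in> std_gaussian m \<Otimes>\<^sub>M uniform_measure lborel {0..r}
       \<rightarrow>\<^sub>M PiM X (\<lambda>_. count_space UNIV) \<Otimes>\<^sub>M PiM Y (\<lambda>_. count_space UNIV)"
  unfolding case_prod_beta
  by (intro measurable_Pair measurable_restrict L2_hash_measurable)

lemma asymmetric_hash_L2_ALSH_SL:
  fixes X Y :: "(real ^ 'n::finite) set"
  assumes "r > 0"
  shows "asymmetric_hash X Y (L2_ALSH_SL m U r X Y)"
proof -
  let ?T = "PiM X (\<lambda>_. count_space UNIV) \<Otimes>\<^sub>M PiM Y (\<lambda>_. count_space UNIV)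
    :: ((real ^ 'n \<Rightarrow> int) \<times> (real ^ 'n \<Rightarrow> int)) measure"
  interpret G: prob_space "std_gaussian m" by (rule prob_space_std_gaussian)
  interpret B: prob_space "uniform_measure lborel {0..r}" using assms by (rule prob_space_uniform)
  interpret GB: pair_prob_space "std_gaussian m" "uniform_measure lborel {0..r}" ..
  have "prob_space (L2_ALSH_SL m U r X Y)"
    unfolding L2_ALSH_SL_def by (intro GB.prob_space_distr L2_ALSH_SL_measurable)
  moreover have "collision (L2_ALSH_SL m U r X Y) x y \<in> sets (L2_ALSH_SL m U r X Y)"
    if "x \<in> X" "y \<in> Y" for x y
  proof -
    have [measurable]: "(\<lambda>h. fst h x) \<in> ?T \<rightarrow>\<^sub>M count_space UNIV"
      by (intro measurable_compose[OF measurable_fst] measurable_component_singleton that)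
    have [measurable]: "(\<lambda>h. snd h y) \<in> ?T \<rightarrow>\<^sub>M count_space UNIV"
      by (intro measurable_compose[OF measurable_snd] measurable_component_singleton that)
    have "{h \<in> space ?T. \<exists>k. fst h x = k \<and> snd h y = k} \<in> sets ?T"
      by measurable
    moreover have "collision (L2_ALSH_SL m U r X Y) x y = {h \<in> space ?T. \<exists>k. fst h x = k \<and> snd h y = k}"
      unfolding collision_def L2_ALSH_SL_def space_distr by auto
    ultimately show ?thesis
      unfolding L2_ALSH_SL_def sets_distr by metis
  qed
  ultimately show ?thesis
    by (auto simp: asymmetric_hash_def L2_ALSH_SL_def space_pair_measure space_PiM)
qed

end

theory Submission
  imports Defs
begin

text \<open>
  Shifting by the uniform offset \<open>b\<close> makes \<open>s\<close> and \<open>t\<close> collide with probability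
  \<open>max 0 (1 - \<bar>s - t\<bar> / r)\<close>, and \<open>a \<bullet> (P x - Q y)\<close> is distributed as \<open>\<delta> Z\<close> with \<open>Z\<close> standard normal and
  \<open>\<delta> = \<parallel>P x - Q y\<parallel>\<close>. So the collision probability is antitone in \<open>\<delta>\<close>.  For a unit vector \<open>e\<close>, the pairs
  \<open>(S e, e)\<close> and \<open>(S e, c e)\<close> have similarities \<open>S\<close> and \<open>c S\<close>, share \<open>P (S e)\<close>, and satisfy
  \<open>\<delta>\<^sup>2(S e, e) - \<delta>\<^sup>2(S e, c e) = (U S - 1)\<^sup>2 - (U S - c)\<^sup>2 = (1 - c) (1 + c - 2 U S) \<ge> 0\<close>,
  hence the more similar pair collides at most as often.
\<close>

lemma floor_divide_eq_iff:
  fixes z r :: real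
  assumes "r > 0"
  shows "\<lfloor>z / r\<rfloor> = j \<longleftrightarrow> of_int j * r \<le> z \<and> z < (of_int j + 1) * r"
  using assms by (simp add: floor_eq_iff pos_le_divide_eq pos_divide_less_eq)

text \<open>As \<open>b\<close> runs over \<open>{0..r}\<close>, each of \<open>s + b\<close> and
  \<open>t + b\<close> meets a cell boundary once. The offsets separating the two points have total
  length \<open>min (t - s) r\<close>, whatever their positions in the cells.\<close>

lemma emeasure_uniform_shared_cell_le:
  fixes r s t :: real
  assumes "r > 0" "s \<le> t"
  shows "emeasure (uniform_measure lborel {0..r}) {b. \<lfloor>(s + b) / r\<rfloor> = \<lfloor>(t + b) / r\<rfloor>} =
    ennreal (max 0 (1 - (t - s) / r))"
proof -
  let ?C = "{b. \<lfloor>(s + b) / r\<rfloor> = \<lfloor>(t + b) / r\<rfloor>}"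
  define k where "k = \<lfloor>s / r\<rfloor> + 1"
  \<comment> \<open>distance from \<open>s\<close> to the next cell boundary, which is \<open>k * r\<close>\<close>
  define w where "w = of_int k * r - s"
  have "of_int (k - 1) * r \<le> s \<and> s < (of_int (k - 1) + 1) * r"
    using floor_divide_eq_iff[OF assms(1), of s "k - 1"] by (simp add: k_def)
  then have w: "0 < w" "w \<le> r"
    by (auto simp: w_def algebra_simps)
  have floor_s: "\<lfloor>(s + b) / r\<rfloor> = (if b < w then k - 1 else k)" if "b \<in> {0..r}" for b
    using that w by (auto simp: floor_divide_eq_iff[OF assms(1)] w_def algebra_simps)
  have "emeasure lborel ({0..r} \<inter> ?C) = ennreal (max 0 (r - (t - s)))"
  proof (cases "t - s < w")
    case True
    \<comment> \<open>Here \<open>t\<close> starts in the cell of \<open>s\<close> and crosses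
      \<open>k * r\<close> first, at \<open>b = w - (t - s)\<close>. The points agree before both
      crossings and again after both.\<close>
    have floor_t: "\<lfloor>(t + b) / r\<rfloor> = (if b < w - (t - s) then k - 1 else k)" if "b \<in> {0..r}" for b
      using that w True assms(2) by (auto simp: floor_divide_eq_iff[OF assms(1)] w_def algebra_simps)
    have "{0..r} \<inter> ?C = {0..<w - (t - s)} \<union> {w..r}"
      using floor_s floor_t w True assms by (auto split: if_splits)
    moreover have "emeasure lborel ({0..<w - (t - s)} \<union> {w..r}) = ennreal (w - (t - s)) + ennreal (r - w)"
      using w True assms by (subst plus_emeasure[symmetric]) auto
    ultimately show ?thesis
      using w True assms by (simp flip: ennreal_plus)
  next
    case False
    show ?thesis
    proof (cases "t - s < r")
      case True
      \<comment> \<open>Now \<open>t\<close> starts in cell \<open>k\<close>, which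
        \<open>s + b\<close> enters at \<open>b = w\<close> and \<open>t + b\<close> leaves at
        \<open>b = w + r - (t - s)\<close>; agreement holds exactly in between.\<close>
      have floor_t: "\<lfloor>(t + b) / r\<rfloor> = (if b < w + r - (t - s) then k else k + 1)" if "b \<in> {0..r}" for b
        using that w True False assms(2)
        by (auto simp: floor_divide_eq_iff[OF assms(1)] w_def algebra_simps)
      have "{0..r} \<inter> ?C = {w..<w + r - (t - s)}"
        using floor_s floor_t w True False assms by (auto split: if_splits)
      then show ?thesis
        using True by simp
    next
      case far: False
      \<comment> \<open>At distance at least \<open>r\<close>, \<open>t + b\<close> is always in a
        strictly later cell: the first bound handles \<open>b < w\<close>, the second
        \<open>w \<le> b\<close>.\<close>
      have "k \<le> \<lfloor>(t + b) / r\<rfloor>" if "b \<in> {0..r}" for b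
        using that w far assms False by (simp add: le_floor_iff pos_le_divide_eq w_def)
      moreover have "k + 1 \<le> \<lfloor>(t + b) / r\<rfloor>" if "b \<in> {0..r}" "w \<le> b" for b
        using that w far assms by (simp add: le_floor_iff pos_le_divide_eq w_def algebra_simps)
      ultimately have "{0..r} \<inter> ?C = {}"
        using floor_s by (force split: if_splits)
      then show ?thesis
        using far by (simp add: max_def)
    qed
  qed
  moreover have "?C \<in> sets lborel"
    by measurable
  ultimately have "emeasure (uniform_measure lborel {0..r}) ?C = ennreal (max 0 (r - (t - s))) / ennreal r"
    using assms(1) by (simp del: ennreal_max_0 ennreal_max_0')
  also have "\<dots> = ennreal (max 0 (r - (t - s)) / r)"
    using assms(1) by (intro divide_ennreal) auto
  also have "max 0 (r - (t - s)) / r = max 0 (1 - (t - s) / r)"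
    using assms(1) by (simp add: max_divide_distrib_right diff_divide_distrib)
  finally show ?thesis .
qed

lemma emeasure_uniform_shared_cell:
  fixes r s t :: real
  assumes "r > 0"
  shows "emeasure (uniform_measure lborel {0..r}) {b. \<lfloor>(s + b) / r\<rfloor> = \<lfloor>(t + b) / r\<rfloor>} =
    ennreal (max 0 (1 - \<bar>s - t\<bar> / r))"
proof (cases "s \<le> t")
  case True
  then show ?thesis
    using emeasure_uniform_shared_cell_le[OF assms] by simp
next
  case False
  have "{b. \<lfloor>(s + b) / r\<rfloor> = \<lfloor>(t + b) / r\<rfloor>} = {b. \<lfloor>(t + b) / r\<rfloor> = \<lfloor>(s + b) / r\<rfloor>}"
    by auto
  then show ?thesis
    using False emeasure_uniform_shared_cell_le[OF assms, of t s] by simp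
qed

text \<open>Characteristic functions also cover \<open>v = 0\<close>, a point mass with no density.
  This case occurs when a coordinate of \<open>P x - Q y\<close> vanishes.\<close>

lemma distr_scaled_std_normal:
  fixes t v :: real
  shows "real_distribution (distr std_normal_distribution borel (\<lambda>x. v * x))"
    and "char (distr std_normal_distribution borel (\<lambda>x. v * x)) t = exp (- ((t * v)\<^sup>2) / 2)"
proof -
  interpret N: real_distribution std_normal_distribution
    by (rule real_dist_normal_dist)
  show "real_distribution (distr std_normal_distribution borel (\<lambda>x. v * x))"
    by (rule N.real_distribution_distr) simp
  have "char (distr std_normal_distribution borel (\<lambda>x. v * x)) t = char std_normal_distribution (t * v)"
    unfolding char_def by (subst integral_distr) (auto simp: mult.assoc)
  then show "char (distr std_normal_distribution borel (\<lambda>x. v * x)) t = exp (- ((t * v)\<^sup>2) / 2)"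
    by (simp add: char_std_normal_distribution exp_of_real)
qed

text \<open>Independence means that the joint law is the product of the marginals. Here the joint
  law is \<open>PiM I M\<close> itself and the marginals are the \<open>M i\<close>. The criterion
  used needs a nonempty index set, hence the case split.\<close>

lemma indep_vars_PiM_components:
  assumes "\<And>i. i \<in> I \<Longrightarrow> prob_space (M i)"
  shows "prob_space.indep_vars (PiM I M) M (\<lambda>i \<omega>. \<omega> i) I"
proof (cases "I = {}")
  case True
  interpret prob_space "PiM I M"
    using assms by (rule prob_space_PiM)
  show ?thesis
    unfolding indep_vars_def2 indep_sets_def using True by auto
next
  case False
  interpret prob_space "PiM I M"
    using assms by (rule prob_space_PiM)
  have "distr (PiM I M) (PiM I M) (\<lambda>x. restrict x I) = distr (PiM I M) (PiM I M) (\<lambda>x. x)"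
    by (rule distr_cong) (auto simp: space_PiM)
  also have "\<dots> = PiM I (\<lambda>i. distr (PiM I M) (M i) (\<lambda>\<omega>. \<omega> i))"
    using assms by (simp add: distr_id distr_PiM_component cong: PiM_cong)
  finally show ?thesis
    using False by (subst indep_vars_iff_distr_eq_PiM') (auto simp: restrict_def)
qed

text \<open>Stability of the Gaussian: by independence the characteristic functions of the summands
  multiply, so the exponents \<open>- (t * v i)\<^sup>2 / 2\<close> add up, and Levy uniqueness
  identifies the laws.\<close>

lemma distr_PiM_std_normal_linear:
  fixes v :: "'i \<Rightarrow> real"
  assumes "finite I"
  shows "distr (PiM I (\<lambda>_. std_normal_distribution)) borel (\<lambda>a. \<Sum>i\<in>I. a i * v i) =
    distr std_normal_distribution borel (\<lambda>x. sqrt (\<Sum>i\<in>I. (v i)\<^sup>2) * x)"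
proof -
  let ?N = "std_normal_distribution"
  let ?M = "PiM I (\<lambda>_. ?N)"
  have N: "prob_space ?N"
    by (rule prob_space_normal_density) simp
  interpret prob_space ?M
    using N by (rule prob_space_PiM)
  have comp: "distr ?M ?N (\<lambda>a. a i) = ?N" if "i \<in> I" for i
    using N that by (rule distr_PiM_component)
  have meas: "(\<lambda>a. a i) \<in> ?M \<rightarrow>\<^sub>M ?N" if "i \<in> I" for i
    using that by (rule measurable_component_singleton)
  then have [measurable]: "(\<lambda>a. a i) \<in> borel_measurable ?M" if "i \<in> I" for i
    using that by simp
  have "indep_vars (\<lambda>_. ?N) (\<lambda>i a. a i) I"
    using N by (rule indep_vars_PiM_components)
  then have indep: "indep_vars (\<lambda>_. borel) (\<lambda>i a. a i * v i) I"
    by (rule indep_vars_compose2) simp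
  have "distr ?M borel (\<lambda>a. a i * v i) = distr ?N borel (\<lambda>x. v i * x)" if "i \<in> I" for i
  proof -
    have "distr ?M borel (\<lambda>a. a i * v i) = distr (distr ?M ?N (\<lambda>a. a i)) borel (\<lambda>x. v i * x)"
      using meas[OF that] by (subst distr_distr) (auto simp: comp_def mult.commute)
    then show ?thesis
      using comp[OF that] by simp
  qed
  then have "char (distr ?M borel (\<lambda>a. \<Sum>i\<in>I. a i * v i)) t =
      char (distr ?N borel (\<lambda>x. sqrt (\<Sum>i\<in>I. (v i)\<^sup>2) * x)) t" for t
    using assms
    by (simp add: char_distr_sum[OF indep] distr_scaled_std_normal sum_nonneg power_mult_distrib
        sum_distrib_left sum_divide_distrib sum_negf flip: exp_sum exp_of_real of_real_prod)
  moreover have "real_distribution (distr ?M borel (\<lambda>a. \<Sum>i\<in>I. a i * v i))"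
    by (rule real_distribution_distr) simp
  ultimately show ?thesis
    by (intro Levy_uniqueness distr_scaled_std_normal ext)
qed

text \<open>Both hashes share \<open>a\<close> and \<open>b\<close>. Integrating out
  \<open>b\<close> for fixed \<open>a\<close> leaves a function of the projection of
  \<open>P x - Q y\<close> on \<open>a\<close> alone, whose law is a scaled standard normal.\<close>

lemma emeasure_collision_L2_ALSH_SL:
  fixes X Y :: "(real ^ 'n::finite) set"
  assumes "r > 0" "x \<in> X" "y \<in> Y"
  shows "emeasure (L2_ALSH_SL m U r X Y) (collision (L2_ALSH_SL m U r X Y) x y) =
    (\<integral>\<^sup>+z. ennreal (max 0 (1 - \<bar>sqrt (\<Sum>i\<in>ext_index m. (SL_P m U x i - SL_Q m y i)\<^sup>2) * z\<bar> / r))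
       \<partial>std_normal_distribution)"
proof -
  let ?G = "std_gaussian m :: ('n + nat \<Rightarrow> real) measure"
  let ?B = "uniform_measure lborel {0..r}"
  let ?H = "L2_ALSH_SL m U r X Y"
  let ?p = "SL_P m U x" and ?q = "SL_Q m y"
  let ?I = "ext_index m :: ('n + nat) set"
  let ?E = "{w \<in> space (?G \<Otimes>\<^sub>M ?B). L2_hash m r (fst w) (snd w) ?p = L2_hash m r (fst w) (snd w) ?q}"
  interpret B: prob_space ?B
    using assms(1) by (rule prob_space_uniform)
  have coll: "collision ?H x y \<in> sets ?H"
    using asymmetric_hash_L2_ALSH_SL[OF assms(1), where X=X and Y=Y and m=m and U=U] assms(2,3)
    by (auto simp: asymmetric_hash_def)
  note [measurable] = L2_hash_measurable
  have E: "?E \<in> sets (?G \<Otimes>\<^sub>M ?B)"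
    by measurable
  have [measurable]: "(\<lambda>a. \<Sum>i\<in>?I. a i * v i) \<in> borel_measurable ?G" for v
  proof (intro borel_measurable_sum borel_measurable_times)
    fix i :: "'n + nat" assume "i \<in> ?I"
    then show "(\<lambda>a. a i) \<in> borel_measurable ?G"
      unfolding std_gaussian_def
      using measurable_component_singleton[of i ?I "\<lambda>_. std_normal_distribution"] by simp
  qed simp
  have "emeasure ?H (collision ?H x y) = emeasure (?G \<Otimes>\<^sub>M ?B) ?E"
    unfolding L2_ALSH_SL_def
    using coll assms(2,3)
    by (subst emeasure_distr[OF L2_ALSH_SL_measurable])
       (auto simp: L2_ALSH_SL_def collision_def space_PiM space_pair_measure intro!: arg_cong2[where f=emeasure])
  also have "\<dots> = (\<integral>\<^sup>+a. emeasure ?B (Pair a -` ?E) \<partial>?G)"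
    using E by (rule B.emeasure_pair_measure_alt)
  also have "\<dots> = (\<integral>\<^sup>+a. ennreal (max 0 (1 - \<bar>\<Sum>i\<in>?I. a i * (?p i - ?q i)\<bar> / r)) \<partial>?G)"
  proof (rule nn_integral_cong)
    fix a assume "a \<in> space ?G"
    then have "Pair a -` ?E =
        {b. \<lfloor>((\<Sum>i\<in>?I. a i * ?p i) + b) / r\<rfloor> = \<lfloor>((\<Sum>i\<in>?I. a i * ?q i) + b) / r\<rfloor>}"
      by (auto simp: L2_hash_def space_pair_measure)
    then show "emeasure ?B (Pair a -` ?E) = ennreal (max 0 (1 - \<bar>\<Sum>i\<in>?I. a i * (?p i - ?q i)\<bar> / r))"
      using emeasure_uniform_shared_cell[OF assms(1)] by (simp add: right_diff_distrib sum_subtractf)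
  qed
  also have "\<dots> = (\<integral>\<^sup>+s. ennreal (max 0 (1 - \<bar>s\<bar> / r)) \<partial>distr ?G borel (\<lambda>a. \<Sum>i\<in>?I. a i * (?p i - ?q i)))"
    by (subst nn_integral_distr) auto
  also have "\<dots> = (\<integral>\<^sup>+z. ennreal (max 0 (1 - \<bar>sqrt (\<Sum>i\<in>?I. (?p i - ?q i)\<^sup>2) * z\<bar> / r)) \<partial>std_normal_distribution)"
    unfolding std_gaussian_def distr_PiM_std_normal_linear[OF finite_ext_index]
    by (subst nn_integral_distr) auto
  finally show ?thesis .
qed

text \<open>The integrand in the collision formula is antitone in the scale for each
  \<open>z\<close> separately, so the integrals compare without being evaluated.\<close>

lemma measure_collision_L2_ALSH_SL_antimono:
  fixes X Y :: "(real ^ 'n::finite) set"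
  assumes "r > 0" "x \<in> X" "y \<in> Y" "x' \<in> X" "y' \<in> Y"
    and "(\<Sum>i\<in>ext_index m. (SL_P m U x' i - SL_Q m y' i)\<^sup>2) \<le>
      (\<Sum>i\<in>ext_index m. (SL_P m U x i - SL_Q m y i)\<^sup>2)"
  shows "measure (L2_ALSH_SL m U r X Y) (collision (L2_ALSH_SL m U r X Y) x y)
    \<le> measure (L2_ALSH_SL m U r X Y) (collision (L2_ALSH_SL m U r X Y) x' y')"
proof -
  let ?H = "L2_ALSH_SL m U r X Y"
  interpret prob_space ?H
    using asymmetric_hash_L2_ALSH_SL[OF assms(1), where X=X and Y=Y and m=m and U=U]
    by (simp add: asymmetric_hash_def)
  have "emeasure ?H (collision ?H x y) \<le> emeasure ?H (collision ?H x' y')"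
    unfolding emeasure_collision_L2_ALSH_SL[OF assms(1-3)] emeasure_collision_L2_ALSH_SL[OF assms(1,4,5)]
    using assms(1,6)
    by (intro nn_integral_mono ennreal_leI max.mono diff_left_mono divide_right_mono)
       (auto simp: abs_mult sum_nonneg intro!: mult_right_mono)
  then show ?thesis
    by (simp add: emeasure_eq_measure)
qed

theorem theorem5p2:
  fixes c S :: real
  assumes "0 < c" and "c < 1" and "0 < S" and "S < (c + 1) / 2"
  shows "\<not> (\<exists>(U::real) (m::nat) (r::real). 0 < U \<and> U < 1 \<and> 1 \<le> m \<and> 0 < r \<and>
           ALSH (\<lambda>x y. x \<bullet> y) {x :: real ^ 'n::finite. norm x \<le> 1} {x. norm x \<le> 1} S c
             (L2_ALSH_SL m U r {x. norm x \<le> 1} {x. norm x \<le> 1}))"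
proof
  let ?D = "{x :: real ^ 'n. norm x \<le> 1}"
  assume "\<exists>(U::real) (m::nat) (r::real). 0 < U \<and> U < 1 \<and> 1 \<le> m \<and> 0 < r \<and>
    ALSH (\<lambda>x y. x \<bullet> y) ?D ?D S c (L2_ALSH_SL m U r ?D ?D)"
  then obtain U r :: real and m :: nat where
    U: "0 < U" "U < 1" and r: "0 < r" and alsh: "ALSH (\<lambda>x y. x \<bullet> y) ?D ?D S c (L2_ALSH_SL m U r ?D ?D)"
    by blast
  let ?H = "L2_ALSH_SL m U r ?D ?D"
  obtain p1 p2 where p: "p2 < p1" and H: "ALSH_with (\<lambda>x y. x \<bullet> y) ?D ?D S c p1 p2 ?H"
    using alsh by (auto simp: ALSH_def)
  \<comment> \<open>Types are inhabited, so the dimension is at least 1 and a coordinate direction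
    exists.\<close>
  obtain k :: 'n where True by simp
  define e :: "real ^ 'n" where "e = axis k 1"
  have e: "norm e = 1" "e \<bullet> e = 1"
    by (simp_all add: e_def norm_axis_1 inner_axis_axis)
  \<comment> \<open>The first membership uses \<open>S < (c + 1) / 2 < 1\<close>.\<close>
  have D: "S *\<^sub>R e \<in> ?D" "e \<in> ?D" "c *\<^sub>R e \<in> ?D"
    using assms e by auto
  have "U * S \<le> S"
    using U assms mult_right_mono[of U 1 S] by simp
  moreover have "2 * S < c + 1"
    using assms by simp
  ultimately have "2 * (U * S) \<le> 1 + c"
    by linarith
  then have "0 \<le> (1 - c) * (1 + c - 2 * (U * S))"
    using assms by (intro mult_nonneg_nonneg) simp_all
  then have sq: "(U * S - c)\<^sup>2 \<le> (U * S - 1)\<^sup>2"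
    by (simp add: power2_eq_square algebra_simps)
  \<comment> \<open>Only coordinate \<open>Inl k\<close> differs between the two sides, and there
    the bound is \<open>sq\<close>: the appended part of \<open>SL_Q\<close> does not depend on the
    data vector.\<close>
  have "(SL_P m U (S *\<^sub>R e) i - SL_Q m (c *\<^sub>R e) i)\<^sup>2 \<le> (SL_P m U (S *\<^sub>R e) i - SL_Q m e i)\<^sup>2" for i
    using sq by (cases i) (auto simp: SL_P_def SL_Q_def e_def axis_def)
  then have "measure ?H (collision ?H (S *\<^sub>R e) e) \<le> measure ?H (collision ?H (S *\<^sub>R e) (c *\<^sub>R e))"
    using r D by (intro measure_collision_L2_ALSH_SL_antimono sum_mono) auto
  moreover have "p1 \<le> measure ?H (collision ?H (S *\<^sub>R e) e)"
    using H D e unfolding ALSH_with_def by force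
  moreover have "measure ?H (collision ?H (S *\<^sub>R e) (c *\<^sub>R e)) \<le> p2"
    using H D e unfolding ALSH_with_def by force
  ultimately show False
    using p by linarith
qed

end
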